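(* For even $n\geq 2$, let $\mathrm{Dic}_n=\langle a,x \mid a^{2n}=e,\ x^2=a^n,\ x^{-1}ax=a^{-1}\rangle$ be the dicyclic group of order $4n$. Then Player 2 has a winning strategy for $\texttt{REL}(\mathrm{Dic}_n,\{a,x\})$.
   Context: Game $\texttt{REL}(G,S)$: $G$ is a finite group and $S$ a generating set with $e\notin S$. Two players alternate turns, Player 1 first, starting from the empty word $w_0$. On turn $n$ the current player chooses $s_n\in S\cup S^{-1}$, subject to $s_n\neq s_{n-1}^{-1}$ when $n>1$, and forms $w_n=w_{n-1}s_n$. If $w_n$ represents the same element of $G$ as some $w_k$ with $0\le k<n$, the player who formed $w_n$ wins. If a player has no legal move, that player loses. *)

theory Defs
  imports "HOL-Algebra.Algebra"
begin

section \<open>Group presentations\<close>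

text \<open>The letter \<open>(g, True)\<close> is the generator \<open>g\<close> and \<open>(g, False)\<close> is its formal inverse.
  GenA relation \<open>u = v\<close> is the pair \<open>(u, v)\<close>.\<close>

type_synonym 'g word = "('g \<times> bool) list"

inductive pres_eq :: "('g word \<times> 'g word) set \<Rightarrow> 'g word \<Rightarrow> 'g word \<Rightarrow> bool"
  for R :: "('g word \<times> 'g word) set" where
  refl: "pres_eq R u u"
| sym: "pres_eq R u v \<Longrightarrow> pres_eq R v u"
| trans: "pres_eq R u v \<Longrightarrow> pres_eq R v w \<Longrightarrow> pres_eq R u w"
| append: "pres_eq R u u' \<Longrightarrow> pres_eq R v v' \<Longrightarrow> pres_eq R (u @ v) (u' @ v')"
| cancel: "pres_eq R [(g, b), (g, \<not> b)] []"
| relation: "(u, v) \<in> R \<Longrightarrow> pres_eq R u v"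

definition pres_class :: "('g word \<times> 'g word) set \<Rightarrow> 'g word \<Rightarrow> 'g word set" where
  "pres_class R u = {v. pres_eq R u v}"

text \<open>The generators are all elements of the type \<open>'g\<close>.\<close>

definition presented_group :: "('g word \<times> 'g word) set \<Rightarrow> 'g word set monoid" where
  "presented_group R =
     \<lparr>carrier = range (pres_class R),
      monoid.mult = (\<lambda>P Q. {w. \<exists>u\<in>P. \<exists>v\<in>Q. pres_eq R (u @ v) w}),
      monoid.one = pres_class R []\<rparr>"

section \<open>Dicyclic groups\<close>

datatype dic_gen = GenA | GenX

definition dic_relations :: "nat \<Rightarrow> (dic_gen word \<times> dic_gen word) set" where
  "dic_relations n =
     {(replicate (2 * n) (GenA, True), []),
      ([(GenX, True), (GenX, True)], replicate n (GenA, True)),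
      ([(GenX, False), (GenA, True), (GenX, True)], [(GenA, False)])}"

definition Dic :: "nat \<Rightarrow> dic_gen word set monoid" where
  "Dic n = presented_group (dic_relations n)"

definition dic_a :: "nat \<Rightarrow> dic_gen word set" where
  "dic_a n = pres_class (dic_relations n) [(GenA, True)]"

definition dic_x :: "nat \<Rightarrow> dic_gen word set" where
  "dic_x n = pres_class (dic_relations n) [(GenX, True)]"

section \<open>The game REL\<close>

locale rel_game = group G for G :: "('a, 'b) monoid_scheme" (structure) +
  fixes S :: "'a set"
  assumes finite_carrier: "finite (carrier G)"
    and S_subset: "S \<subseteq> carrier G"
    and S_generates: "generate G S = carrier G"
    and one_notin_S: "\<one> \<notin> S"

text \<open>GenA history is the list \<open>[s\<^sub>1, \<dots>, s\<^sub>m]\<close> of the moves made so far; \<open>w\<^sub>k\<close> is represented by its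
  value in \<open>G\<close>.\<close>

definition word_value :: "('a, 'b) monoid_scheme \<Rightarrow> 'a list \<Rightarrow> 'a" where
  "word_value G h = foldl (monoid.mult G) (monoid.one G) h"

definition legal_move :: "('a, 'b) monoid_scheme \<Rightarrow> 'a set \<Rightarrow> 'a list \<Rightarrow> 'a \<Rightarrow> bool" where
  "legal_move G S h s \<longleftrightarrow>
     s \<in> S \<union> m_inv G ` S \<and> (h \<noteq> [] \<longrightarrow> s \<noteq> m_inv G (last h))"

definition repeats :: "('a, 'b) monoid_scheme \<Rightarrow> 'a list \<Rightarrow> bool" where
  "repeats G h \<longleftrightarrow> (\<exists>k < length h. word_value G (take k h) = word_value G h)"

text \<open>The game stops at the first repetition, so no proper prefix of a play has one.\<close>

definition is_play :: "('a, 'b) monoid_scheme \<Rightarrow> 'a set \<Rightarrow> 'a list \<Rightarrow> bool" where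
  "is_play G S h \<longleftrightarrow>
     (\<forall>i < length h. \<not> repeats G (take i h) \<and> legal_move G S (take i h) (h ! i))"

datatype player = Player1 | Player2

definition player_on_turn :: "nat \<Rightarrow> player" where
  "player_on_turn m = (if odd m then Player1 else Player2)"

definition to_move :: "'a list \<Rightarrow> player" where
  "to_move h = player_on_turn (Suc (length h))"

definition won_by :: "('a, 'b) monoid_scheme \<Rightarrow> 'a set \<Rightarrow> 'a list \<Rightarrow> player \<Rightarrow> bool" where
  "won_by G S h p \<longleftrightarrow>
     (if repeats G h then player_on_turn (length h) = p
      else (\<nexists>s. legal_move G S h s) \<and> to_move h \<noteq> p)"

definition game_over :: "('a, 'b) monoid_scheme \<Rightarrow> 'a set \<Rightarrow> 'a list \<Rightarrow> bool" where
  "game_over G S h \<longleftrightarrow> repeats G h \<or> (\<nexists>s. legal_move G S h s)"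

definition follows :: "player \<Rightarrow> ('a list \<Rightarrow> 'a) \<Rightarrow> 'a list \<Rightarrow> bool" where
  "follows p \<sigma> h \<longleftrightarrow>
     (\<forall>i < length h. to_move (take i h) = p \<longrightarrow> h ! i = \<sigma> (take i h))"

text \<open>Every play on a finite group is finite (lemma \<open>play_length\<close> below), so it suffices to speak
  about finite histories.\<close>

definition winning_strategy ::
  "('a, 'b) monoid_scheme \<Rightarrow> 'a set \<Rightarrow> player \<Rightarrow> ('a list \<Rightarrow> 'a) \<Rightarrow> bool" where
  "winning_strategy G S p \<sigma> \<longleftrightarrow>
     (\<forall>h. is_play G S h \<and> follows p \<sigma> h \<longrightarrow>
        (if game_over G S h then won_by G S h p
         else to_move h = p \<longrightarrow> legal_move G S h (\<sigma> h)))"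

definition has_winning_strategy ::
  "('a, 'b) monoid_scheme \<Rightarrow> 'a set \<Rightarrow> player \<Rightarrow> bool" where
  "has_winning_strategy G S p \<longleftrightarrow> (\<exists>\<sigma>. winning_strategy G S p \<sigma>)"

section \<open>Well-definedness\<close>

lemma (in rel_game) word_value_closed:
  "set h \<subseteq> S \<union> m_inv G ` S \<Longrightarrow> word_value G h \<in> carrier G"
proof (induction h rule: rev_induct)
  case Nil
  then show ?case by (simp add: word_value_def)
next
  case (snoc s h)
  then have "s \<in> carrier G" using S_subset by auto
  with snoc show ?case by (auto simp: word_value_def)
qed

lemma (in rel_game) play_length:
  assumes h: "is_play G S h"
  shows "length h \<le> card (carrier G)"
proof -
  have "h ! i \<in> S \<union> m_inv G ` S" if "i < length h" for i
    using h that unfolding is_play_def legal_move_def by blast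
  then have sub: "set h \<subseteq> S \<union> m_inv G ` S" by (metis in_set_conv_nth subsetI)
  let ?w = "\<lambda>i. word_value G (take i h)"
  have ne: "?w i \<noteq> ?w j" if "i < j" "j < length h" for i j
  proof -
    have "\<not> repeats G (take j h)" using h that unfolding is_play_def by blast
    then show ?thesis using that by (auto simp: repeats_def min_def)
  qed
  have "inj_on ?w {..<length h}"
    by (rule inj_onI) (metis ne lessThan_iff linorder_neqE_nat)
  moreover have "?w ` {..<length h} \<subseteq> carrier G"
    using sub by (auto intro!: word_value_closed dest: in_set_takeD)
  ultimately show ?thesis
    using card_inj_on_le[of ?w "{..<length h}" "carrier G"] finite_carrier by simp
qed

lemma pres_class_eq_iff: "pres_class R u = pres_class R v \<longleftrightarrow> pres_eq R u v"
  unfolding pres_class_def by (blast intro: pres_eq.refl pres_eq.sym pres_eq.trans)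

lemma presented_group_mult:
  "monoid.mult (presented_group R) (pres_class R u) (pres_class R v) = pres_class R (u @ v)"
  unfolding presented_group_def pres_class_def
  by (auto intro: pres_eq.refl pres_eq.trans pres_eq.append)

lemma presented_group_one: "monoid.one (presented_group R) = pres_class R []"
  by (simp add: presented_group_def)

lemma presented_group_carrier: "carrier (presented_group R) = range (pres_class R)"
  by (simp add: presented_group_def)

lemma pres_eq_inverse: "pres_eq R (rev (map (\<lambda>(g, b). (g, \<not> b)) u) @ u) []"
proof (induction u)
  case Nil
  show ?case by (simp add: pres_eq.refl)
next
  case (Cons l u)
  obtain g b where l: "l = (g, b)" by force
  let ?v = "rev (map (\<lambda>(g, b). (g, \<not> b)) u)"
  have "pres_eq R [(g, \<not> b), (g, b)] []" using pres_eq.cancel[of R g "\<not> b"] by simp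
  then have "pres_eq R (?v @ ([(g, \<not> b), (g, b)] @ u)) (?v @ ([] @ u))"
    by (intro pres_eq.append pres_eq.refl)
  with Cons show ?case by (auto simp: l intro: pres_eq.trans)
qed

lemma group_presented_group: "group (presented_group R)"
proof (rule groupI)
  fix P assume "P \<in> carrier (presented_group R)"
  then obtain u where P: "P = pres_class R u" by (auto simp: presented_group_carrier)
  show "\<exists>Q\<in>carrier (presented_group R). Q \<otimes>\<^bsub>presented_group R\<^esub> P = \<one>\<^bsub>presented_group R\<^esub>"
    using pres_eq_inverse[of R u]
    by (auto simp: P presented_group_carrier presented_group_mult presented_group_one
        pres_class_eq_iff)
qed (auto simp: presented_group_carrier presented_group_mult presented_group_one)

lemma presented_group_inv:
  "m_inv (presented_group R) (pres_class R u) = pres_class R (rev (map (\<lambda>(g, b). (g, \<not> b)) u))"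
  by (rule group.inv_equality[OF group_presented_group])
    (auto simp: presented_group_carrier presented_group_mult presented_group_one
        pres_class_eq_iff pres_eq_inverse)

lemma presented_group_generate:
  "generate (presented_group R) (range (\<lambda>g. pres_class R [(g, True)])) = carrier (presented_group R)"
    (is "generate ?G ?S = _")
proof
  show "generate ?G ?S \<subseteq> carrier ?G"
    by (rule group.generate_incl[OF group_presented_group]) (auto simp: presented_group_carrier)
  have letter: "pres_class R [(g, b)] \<in> generate ?G ?S" for g b
  proof (cases b)
    case True
    then show ?thesis by (auto intro: generate.incl)
  next
    case False
    have "m_inv ?G (pres_class R [(g, True)]) \<in> generate ?G ?S" by (auto intro: generate.inv)
    with False show ?thesis by (simp add: presented_group_inv)
  qed
  have "pres_class R u \<in> generate ?G ?S" for u
  proof (induction u)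
    case Nil
    show ?case using generate.one[of ?G ?S] by (simp add: presented_group_one)
  next
    case (Cons l u)
    obtain g b where "l = (g, b)" by force
    with generate.eng[OF letter[of g b] Cons] show ?case by (simp add: presented_group_mult)
  qed
  then show "carrier ?G \<subseteq> generate ?G ?S" by (auto simp: presented_group_carrier)
qed

text \<open>Right multiplication of the normal form \<open>a\<^sup>i x\<^sup>j\<close>, stored as \<open>(i mod 2 n, j = 1)\<close>, by a letter.\<close>

fun dic_step :: "nat \<Rightarrow> int \<times> bool \<Rightarrow> dic_gen \<times> bool \<Rightarrow> int \<times> bool" where
  "dic_step n (i, j) (GenA, b) = ((if b = j then i - 1 else i + 1) mod (2 * int n), j)"
| "dic_step n (i, j) (GenX, b) = ((if b = j then i + int n else i) mod (2 * int n), \<not> j)"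

definition dic_nf :: "nat \<Rightarrow> dic_gen word \<Rightarrow> int \<times> bool" where
  "dic_nf n w = foldl (dic_step n) (0, False) w"

lemma dic_replicate:
  assumes "i mod (2 * int n) = i"
  shows "foldl (dic_step n) (i, j) (replicate k (GenA, True)) =
     ((if j then i - int k else i + int k) mod (2 * int n), j)"
proof (induction k)
  case 0
  with assms show ?case by simp
next
  case (Suc k)
  then show ?case
    by (simp only: replicate_Suc replicate_append_same[symmetric] foldl_append)
      (auto simp: mod_simps algebra_simps)
qed

lemma dic_foldl_mod:
  "fst p mod (2 * int n) = fst p \<Longrightarrow>
   fst (foldl (dic_step n) p w) mod (2 * int n) = fst (foldl (dic_step n) p w)"
proof (induction w arbitrary: p)
  case (Cons l w)
  have "fst (dic_step n p l) mod (2 * int n) = fst (dic_step n p l)"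
    by (cases "(n, p, l)" rule: dic_step.cases) auto
  with Cons.IH show ?case by simp
qed simp

lemma pres_eq_dic_foldl:
  assumes "pres_eq (dic_relations n) u v"
  shows "fst p mod (2 * int n) = fst p \<Longrightarrow>
    foldl (dic_step n) p u = foldl (dic_step n) p v"
  using assms
proof (induction arbitrary: p rule: pres_eq.induct)
  case (append u u' v v')
  then show ?case by (metis dic_foldl_mod foldl_append)
next
  case (cancel g b)
  obtain i j where p: "p = (i, j)" by force
  have "i + 2 * int n = i + 1 * (2 * int n)" by simp
  then have [simp]: "(i + 2 * int n) mod (2 * int n) = i mod (2 * int n)" by (metis mod_mult_self1)
  show ?case using cancel
    by (cases g) (auto simp: p mod_simps algebra_simps)
next
  case (relation u v)
  obtain i j where p: "p = (i, j)" by force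
  have m: "(i - int n) mod (int n * 2) = (i + int n) mod (int n * 2)"
    "(i + int n * 2 - 1) mod (int n * 2) = (i - 1) mod (int n * 2)"
    using mod_add_self2[of "i - int n" "int n * 2"] mod_add_self2[of "i - 1" "int n * 2"]
    by (simp_all add: algebra_simps)
  from relation show ?case
    by (auto simp: dic_relations_def p dic_replicate mod_simps algebra_simps m)
qed auto


lemma dic_nf_normal_form:
  assumes "0 \<le> i" "i < 2 * int n"
  shows "dic_nf n (replicate (nat i) (GenA, True) @ (if j then [(GenX, True)] else [])) = (i, j)"
  using assms dic_replicate[of 0 n False "nat i"] by (simp add: dic_nf_def)

lemma Dic_letters:
  shows "pres_class (dic_relations n) [(GenA, True)] = dic_a n" "pres_class (dic_relations n) [(GenX, True)] = dic_x n"
    "pres_class (dic_relations n) [(GenA, False)] = m_inv (Dic n) (dic_a n)"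
    "pres_class (dic_relations n) [(GenX, False)] = m_inv (Dic n) (dic_x n)"
  by (simp_all add: dic_a_def dic_x_def Dic_def presented_group_inv)

lemma Dic_closed [simp]: "dic_a n \<in> carrier (Dic n)" "dic_x n \<in> carrier (Dic n)"
  by (auto simp: dic_a_def dic_x_def Dic_def presented_group_carrier)

lemma Dic_group: "group (Dic n)"
  by (simp add: Dic_def group_presented_group)

lemma Dic_pow_a:
  "pres_class (dic_relations n) (replicate k (GenA, True)) = dic_a n [^]\<^bsub>Dic n\<^esub> k"
proof (induction k)
  case 0
  show ?case by (simp add: Dic_def presented_group_one)
next
  case (Suc k)
  have "pres_class (dic_relations n) (replicate (Suc k) (GenA, True)) =
    pres_class (dic_relations n) (replicate k (GenA, True)) \<otimes>\<^bsub>Dic n\<^esub> dic_a n"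
    by (simp add: Dic_def dic_a_def presented_group_mult replicate_append_same)
  with Suc show ?case by simp
qed

lemma Dic_relations:
  "dic_a n [^]\<^bsub>Dic n\<^esub> (2 * n) = \<one>\<^bsub>Dic n\<^esub>"
  "dic_x n \<otimes>\<^bsub>Dic n\<^esub> dic_x n = dic_a n [^]\<^bsub>Dic n\<^esub> n"
  "m_inv (Dic n) (dic_x n) \<otimes>\<^bsub>Dic n\<^esub> dic_a n \<otimes>\<^bsub>Dic n\<^esub> dic_x n = m_inv (Dic n) (dic_a n)"
proof -
  let ?R = "dic_relations n"
  have "pres_class ?R (replicate (2 * n) (GenA, True)) = pres_class ?R []"
    unfolding pres_class_eq_iff by (rule pres_eq.relation) (simp add: dic_relations_def)
  then show "dic_a n [^]\<^bsub>Dic n\<^esub> (2 * n) = \<one>\<^bsub>Dic n\<^esub>"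
    by (simp only: Dic_pow_a) (simp add: Dic_def presented_group_one)
  have "pres_class ?R [(GenX, True), (GenX, True)] = pres_class ?R (replicate n (GenA, True))"
    unfolding pres_class_eq_iff by (rule pres_eq.relation) (simp add: dic_relations_def)
  then show "dic_x n \<otimes>\<^bsub>Dic n\<^esub> dic_x n = dic_a n [^]\<^bsub>Dic n\<^esub> n"
    by (simp add: Dic_pow_a) (simp add: Dic_def dic_x_def presented_group_mult)
  have "pres_class ?R [(GenX, False), (GenA, True), (GenX, True)] = pres_class ?R [(GenA, False)]"
    unfolding pres_class_eq_iff by (rule pres_eq.relation) (simp add: dic_relations_def)
  then show "m_inv (Dic n) (dic_x n) \<otimes>\<^bsub>Dic n\<^esub> dic_a n \<otimes>\<^bsub>Dic n\<^esub> dic_x n = m_inv (Dic n) (dic_a n)"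
    unfolding Dic_letters(4)[symmetric] Dic_letters(3)[symmetric]
    by (simp add: Dic_def dic_x_def dic_a_def presented_group_mult)
qed

lemma Dic_class_eq_nf:
  "pres_class (dic_relations n) w =
     dic_a n [^]\<^bsub>Dic n\<^esub> fst (dic_nf n w) \<otimes>\<^bsub>Dic n\<^esub> (if snd (dic_nf n w) then dic_x n else \<one>\<^bsub>Dic n\<^esub>)"
proof -
  interpret group "Dic n" by (rule Dic_group)
  let ?G = "Dic n" and ?a = "dic_a n" and ?x = "dic_x n"
  define val where "val p = ?a [^]\<^bsub>?G\<^esub> fst p \<otimes>\<^bsub>?G\<^esub> (if snd p then ?x else \<one>\<^bsub>?G\<^esub>)" for p :: "int \<times> bool"
  have a2n: "?a [^]\<^bsub>?G\<^esub> (2 * int n) = \<one>\<^bsub>?G\<^esub>"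
    using Dic_relations(1)[of n] int_pow_int[of ?G ?a "2 * n"] by simp
  have md: "?a [^]\<^bsub>?G\<^esub> (i mod (2 * int n)) = ?a [^]\<^bsub>?G\<^esub> i" for i
  proof -
    have "?a [^]\<^bsub>?G\<^esub> i = ?a [^]\<^bsub>?G\<^esub> (2 * int n * (i div (2 * int n)) + i mod (2 * int n))" by simp
    also have "\<dots> = ?a [^]\<^bsub>?G\<^esub> (2 * int n * (i div (2 * int n))) \<otimes>\<^bsub>?G\<^esub> ?a [^]\<^bsub>?G\<^esub> (i mod (2 * int n))"
      by (rule int_pow_mult) simp
    also have "?a [^]\<^bsub>?G\<^esub> (2 * int n * (i div (2 * int n))) = \<one>\<^bsub>?G\<^esub>"
      by (subst int_pow_pow[symmetric]) (simp_all add: a2n int_pow_one)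
    finally show ?thesis by simp
  qed
  have xx: "?x \<otimes>\<^bsub>?G\<^esub> ?x = ?a [^]\<^bsub>?G\<^esub> int n" using Dic_relations(2)[of n] by (simp add: int_pow_int)
  have ax: "?a \<otimes>\<^bsub>?G\<^esub> ?x = ?x \<otimes>\<^bsub>?G\<^esub> inv\<^bsub>?G\<^esub> ?a"
    using Dic_relations(3)[of n] by (metis Dic_closed inv_closed inv_solve_left' m_assoc m_closed)
  have xa: "?x \<otimes>\<^bsub>?G\<^esub> ?a = inv\<^bsub>?G\<^esub> ?a \<otimes>\<^bsub>?G\<^esub> ?x"
    using ax by (metis Dic_closed inv_closed inv_inv inv_solve_left inv_solve_right m_assoc m_closed)
  have xinv: "inv\<^bsub>?G\<^esub> ?x = ?a [^]\<^bsub>?G\<^esub> int n \<otimes>\<^bsub>?G\<^esub> ?x"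
  proof (rule inv_equality)
    show "?a [^]\<^bsub>?G\<^esub> int n \<otimes>\<^bsub>?G\<^esub> ?x \<otimes>\<^bsub>?G\<^esub> ?x = \<one>\<^bsub>?G\<^esub>"
      using a2n by (simp add: m_assoc xx int_pow_mult[symmetric])
  qed simp_all
  have p1: "?a [^]\<^bsub>?G\<^esub> i \<otimes>\<^bsub>?G\<^esub> ?a = ?a [^]\<^bsub>?G\<^esub> (i + 1)" for i :: int
    by (simp add: int_pow_mult)
  have m1: "?a [^]\<^bsub>?G\<^esub> i \<otimes>\<^bsub>?G\<^esub> inv\<^bsub>?G\<^esub> ?a = ?a [^]\<^bsub>?G\<^esub> (i - 1)" for i :: int
    by (simp add: int_pow_diff)
  have step: "val p \<otimes>\<^bsub>?G\<^esub> pres_class (dic_relations n) [l] = val (dic_step n p l)" for p l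
  proof -
    obtain i j where p: "p = (i, j)" by force
    obtain g b where l: "l = (g, b)" by force
    let ?l = "pres_class (dic_relations n) [l]"
    show ?thesis
    proof (cases g; cases b; cases j)
      assume "g = GenA" "b" "j"
      then show ?thesis
        by (simp add: val_def p l Dic_letters md m_assoc xa) (simp add: m_assoc[symmetric] m1)
    next
      assume "g = GenA" "b" "\<not> j"
      then show ?thesis by (simp add: val_def p l Dic_letters md p1)
    next
      assume "g = GenA" "\<not> b" "j"
      then show ?thesis
        by (simp add: val_def p l Dic_letters md m_assoc ax[symmetric]) (simp add: m_assoc[symmetric] p1)
    next
      assume "g = GenA" "\<not> b" "\<not> j"
      then show ?thesis by (simp add: val_def p l Dic_letters md m1)
    next
      assume "g = GenX" "b" "j"
      then show ?thesis by (simp add: val_def p l Dic_letters md m_assoc xx int_pow_mult)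
    next
      assume "g = GenX" "b" "\<not> j"
      then show ?thesis by (simp add: val_def p l Dic_letters md)
    next
      assume "g = GenX" "\<not> b" "j"
      then show ?thesis by (simp add: val_def p l Dic_letters md m_assoc)
    next
      assume "g = GenX" "\<not> b" "\<not> j"
      then show ?thesis
        by (simp add: val_def p l Dic_letters md xinv) (simp add: m_assoc[symmetric] int_pow_mult)
    qed
  qed
  have "pres_class (dic_relations n) w = val (dic_nf n w)"
  proof (induction w rule: rev_induct)
    case Nil
    show ?case by (simp add: dic_nf_def val_def) (simp add: Dic_def presented_group_one)
  next
    case (snoc l w)
    have "pres_class (dic_relations n) (w @ [l]) =
      pres_class (dic_relations n) w \<otimes>\<^bsub>?G\<^esub> pres_class (dic_relations n) [l]"
      by (simp add: Dic_def presented_group_mult)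
    with snoc step show ?case by (simp add: dic_nf_def)
  qed
  then show ?thesis by (simp add: val_def)
qed

lemma Dic_class_eq_iff:
  "pres_class (dic_relations n) u = pres_class (dic_relations n) v \<longleftrightarrow> dic_nf n u = dic_nf n v"
proof
  assume "pres_class (dic_relations n) u = pres_class (dic_relations n) v"
  then show "dic_nf n u = dic_nf n v"
    by (auto simp: pres_class_eq_iff dic_nf_def intro: pres_eq_dic_foldl)
qed (simp add: Dic_class_eq_nf)

lemma Dic_order:
  assumes "n > 0"
  shows "order (Dic n) = 4 * n"
proof -
  let ?N = "{0..<2 * int n} \<times> (UNIV :: bool set)"
  have "range (dic_nf n) = ?N"
  proof
    have "fst (dic_nf n w) mod (2 * int n) = fst (dic_nf n w)" for w
      unfolding dic_nf_def by (rule dic_foldl_mod) simp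
    then have "fst (dic_nf n w) \<in> {0..<2 * int n}" for w
      using assms by (metis atLeastLessThan_iff mult_pos_pos of_nat_0_less_iff
          pos_mod_bound pos_mod_sign zero_less_numeral)
    then show "range (dic_nf n) \<subseteq> ?N" by (intro image_subsetI) (simp only: mem_Times_iff UNIV_I simp_thms)
    show "?N \<subseteq> range (dic_nf n)"
    proof
      fix p assume "p \<in> ?N"
      then obtain i j where "p = (i, j)" "0 \<le> i" "i < 2 * int n" by auto
      then show "p \<in> range (dic_nf n)" by (metis dic_nf_normal_form rangeI)
    qed
  qed
  moreover have "card (range (pres_class (dic_relations n))) = card (range (dic_nf n))"
  proof -
    define f where "f P = dic_nf n (SOME w. pres_class (dic_relations n) w = P)" for P
    have f: "f (pres_class (dic_relations n) w) = dic_nf n w" for w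
      unfolding f_def Dic_class_eq_iff[symmetric] by (rule someI) (rule HOL.refl)
    have "bij_betw f (range (pres_class (dic_relations n))) (range (dic_nf n))"
      by (auto simp: bij_betw_def inj_on_def f Dic_class_eq_iff image_iff)
    then show ?thesis by (rule bij_betw_same_card)
  qed
  moreover have "card ?N = 4 * n"
    by (simp add: card_cartesian_product)
  ultimately show ?thesis
    by (simp add: order_def Dic_def presented_group_carrier)
qed

lemma Dic_rel_game:
  assumes "n > 0"
  shows "rel_game (Dic n) {dic_a n, dic_x n}"
proof -
  interpret group "Dic n" by (rule Dic_group)
  show ?thesis
  proof
    show "finite (carrier (Dic n))"
      using Dic_order[OF assms] assms by (auto simp: order_def intro: card_ge_0_finite)
    have gens: "(UNIV :: dic_gen set) = {GenA, GenX}" using dic_gen.exhaust by auto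
    show "generate (Dic n) {dic_a n, dic_x n} = carrier (Dic n)"
      using presented_group_generate[of "dic_relations n"]
      by (simp add: gens Dic_def dic_a_def dic_x_def)
    have "dic_nf n [] \<noteq> dic_nf n [(GenA, True)]" "dic_nf n [] \<noteq> dic_nf n [(GenX, True)]"
      using assms by (auto simp: dic_nf_def)
    then have "pres_class (dic_relations n) [] \<noteq> dic_a n" "pres_class (dic_relations n) [] \<noteq> dic_x n"
      by (simp_all only: Dic_class_eq_iff dic_a_def dic_x_def not_False_eq_True)
    moreover have "\<one>\<^bsub>Dic n\<^esub> = pres_class (dic_relations n) []"
      by (simp add: Dic_def presented_group_one)
    ultimately show "\<one>\<^bsub>Dic n\<^esub> \<notin> {dic_a n, dic_x n}" by simp
  qed simp
qed

end

theory Submission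
  imports Defs
begin

text \<open>The second player wins at once when possible and otherwise repeats the letter just played, with one
  exception: if the first player turns by \<open>x\<^sup>\<plusminus>\<^sup>1\<close> after the straight walk \<open>a\<^sup>c\<close> with \<open>2 \<le> c < n\<close> (and \<open>c\<close>
  even, as it is the first player's turn), the second player keeps walking in the same direction along
  the other coset of \<open>\<langle>a\<rangle>\<close>. Afterwards the path advances through the cosets of \<open>\<langle>x\<rangle>\<close>, seen as the columns of
  a strip, two columns at a time: since \<open>x\<^sup>2 = a\<^sup>n\<close>, a repeated \<open>x\<close> only replaces \<open>g\<close> by \<open>g a\<^sup>n\<close>.
  As \<open>n\<close> is even, it is the first player who must enter the last column, next to an element already
  visited. The first player can instead turn back after a repeated \<open>x\<close> and walk alongside the earlier
  path; then parity again makes the second player the one to close it.\<close>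

section \<open>Strategies of the second player\<close>

text \<open>The condition \<open>I\<close> marks histories at which the first player is to move and
  stands to lose. Winning is judged on finite histories, so an invariant suffices. The clause
  \<open>reply\<close> rules out both ways for the first player to win: forming a repetition and
  leaving the opponent without a legal move.\<close>

lemma has_winning_strategy_Player2I:
  assumes Nil: "I []"
    and reply: "\<And>h s. I h \<Longrightarrow> legal_move G S h s \<Longrightarrow> \<not> repeats G (h @ [s]) \<and>
      (\<exists>t. legal_move G S (h @ [s]) t \<and> (repeats G (h @ [s, t]) \<or> I (h @ [s, t])))"
  shows "has_winning_strategy G S Player2"
proof -
  define \<sigma> where
    "\<sigma> h = (SOME t. legal_move G S h t \<and> (repeats G (h @ [t]) \<or> I (h @ [t])))" for h
  have \<sigma>: "legal_move G S (h @ [s]) (\<sigma> (h @ [s])) \<and>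
      (repeats G (h @ [s, \<sigma> (h @ [s])]) \<or> I (h @ [s, \<sigma> (h @ [s])]))"
    if "I h" "legal_move G S h s" for h s
    using someI_ex[of "\<lambda>t. legal_move G S (h @ [s]) t \<and>
        (repeats G (h @ [s] @ [t]) \<or> I (h @ [s] @ [t]))"] reply[OF that]
    by (simp add: \<sigma>_def)
  have inv: "(even (length h) \<longrightarrow> repeats G h \<or> I h) \<and>
      (odd (length h) \<longrightarrow> (\<exists>h' s. h = h' @ [s] \<and> I h' \<and> legal_move G S h' s))"
    if "is_play G S h" "follows Player2 \<sigma> h" for h
    using that
  proof (induction h rule: rev_induct)
    case Nil
    show ?case using assms(1) by simp
  next
    case (snoc s h)
    have play: "is_play G S h" unfolding is_play_def
    proof (intro allI impI)
      fix i assume "i < length h"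
      then show "\<not> repeats G (take i h) \<and> legal_move G S (take i h) (h ! i)"
        using snoc.prems(1) by (auto simp: is_play_def nth_append dest!: spec[of _ i])
    qed
    have follow: "follows Player2 \<sigma> h" unfolding follows_def
    proof (intro allI impI)
      fix i assume "i < length h" "to_move (take i h) = Player2"
      then show "h ! i = \<sigma> (take i h)"
        using snoc.prems(2) by (auto simp: follows_def nth_append dest!: spec[of _ i])
    qed
    have last: "\<not> repeats G h" "legal_move G S h s"
      using snoc.prems(1) by (auto simp: is_play_def dest!: spec[of _ "length h"])
    note IH = snoc.IH[OF play follow]
    show ?case
    proof (cases "even (length h)")
      case True
      then show ?thesis using IH last by auto
    next
      case False
      then have "s = \<sigma> h"
        using snoc.prems(2)
        by (auto simp: follows_def to_move_def player_on_turn_def dest!: spec[of _ "length h"])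
      moreover obtain h' s' where "h = h' @ [s']" "I h'" "legal_move G S h' s'"
        using IH False by auto
      ultimately show ?thesis using False \<sigma>[of h' s'] by auto
    qed
  qed
  have "winning_strategy G S Player2 \<sigma>"
    unfolding winning_strategy_def
  proof (intro allI impI, elim conjE)
    fix h assume h: "is_play G S h" "follows Player2 \<sigma> h"
    show "if game_over G S h then won_by G S h Player2
          else to_move h = Player2 \<longrightarrow> legal_move G S h (\<sigma> h)"
    proof (cases "even (length h)")
      \<comment> \<open>At even length a repetition was formed by Player 2 and a missing move is
        missed by Player 1, so an ended game is won whatever \<open>inv\<close> says.\<close>
      case True
      then show ?thesis
        by (auto simp: game_over_def won_by_def to_move_def player_on_turn_def)
    next
      case False
      then obtain h' s where "h = h' @ [s]" "I h'" "legal_move G S h' s"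
        using inv[OF h] by auto
      then show ?thesis
        using \<sigma>[of h' s] reply[of h' s] by (auto simp: game_over_def)
    qed
  qed
  then show ?thesis by (auto simp: has_winning_strategy_def)
qed

section \<open>The game on normal forms\<close>

definition inv_letter :: "'g \<times> bool \<Rightarrow> 'g \<times> bool" where
  "inv_letter l = (fst l, \<not> snd l)"

definition allowed :: "'g word \<Rightarrow> 'g \<times> bool \<Rightarrow> bool" where
  "allowed w l \<longleftrightarrow> (w \<noteq> [] \<longrightarrow> l \<noteq> inv_letter (last w))"

definition visited :: "nat \<Rightarrow> dic_gen word \<Rightarrow> (int \<times> bool) set" where
  "visited n w = (\<lambda>k. dic_nf n (take k w)) ` {..length w}"

text \<open>It is the player to move after the word \<open>w\<close> who is lost.\<close>

inductive lost :: "nat \<Rightarrow> dic_gen word \<Rightarrow> bool" for n :: nat where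
  lostI: "(\<And>l. allowed w l \<Longrightarrow> dic_nf n (w @ [l]) \<notin> visited n w \<and>
      (\<exists>l'. l' \<noteq> inv_letter l \<and>
        (dic_nf n (w @ [l, l']) \<in> visited n (w @ [l]) \<or> lost n (w @ [l, l'])))) \<Longrightarrow> lost n w"

text \<open>This isolates the premise of \<open>lostI\<close> for one letter, so that the possible
  moves can be refuted separately.\<close>

definition answered :: "nat \<Rightarrow> dic_gen word \<Rightarrow> dic_gen \<times> bool \<Rightarrow> bool" where
  "answered n w l \<longleftrightarrow> dic_nf n (w @ [l]) \<notin> visited n w \<and>
     (\<exists>l'. l' \<noteq> inv_letter l \<and>
       (dic_nf n (w @ [l, l']) \<in> visited n (w @ [l]) \<or> lost n (w @ [l, l'])))"

lemma lost_iff_answered: "lost n w \<longleftrightarrow> (\<forall>l. allowed w l \<longrightarrow> answered n w l)"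
  by (subst lost.simps) (auto simp: answered_def)

lemma dic_nf_Nil [simp]: "dic_nf n [] = (0, False)"
  by (simp add: dic_nf_def)

lemma dic_nf_snoc [simp]: "dic_nf n (w @ [l]) = dic_step n (dic_nf n w) l"
  by (simp add: dic_nf_def)

lemma dic_nf_snoc2 [simp]:
  "dic_nf n (w @ [l, l']) = dic_step n (dic_step n (dic_nf n w) l) l'"
  by (simp add: dic_nf_def)

lemma visited_Nil [simp]: "visited n [] = {(0, False)}"
  by (simp add: visited_def)

lemma visited_snoc [simp]: "visited n (w @ [l]) = insert (dic_step n (dic_nf n w) l) (visited n w)"
proof -
  have "{..length (w @ [l])} = insert (Suc (length w)) {..length w}" by auto
  then show ?thesis by (auto simp: visited_def)
qed

lemma visited_snoc2 [simp]:
  "visited n (w @ [l, l']) =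
     insert (dic_step n (dic_step n (dic_nf n w) l) l')
       (insert (dic_step n (dic_nf n w) l) (visited n w))"
  using visited_snoc[of n "w @ [l]" l'] by (simp del: visited_snoc add: visited_snoc[of n w l])

lemma dic_nf_in_visited: "dic_nf n w \<in> visited n w"
  by (force simp: visited_def)

lemma answeredI:
  assumes "dic_step n (dic_nf n w) l \<notin> visited n w" "l' \<noteq> inv_letter l"
    and "dic_step n (dic_step n (dic_nf n w) l) l' \<in> visited n w \<or> lost n (w @ [l, l'])"
  shows "answered n w l"
  using assms unfolding answered_def dic_nf_snoc dic_nf_snoc2 visited_snoc by blast

section \<open>Transfer from words of letters to moves in the group\<close>

context
  fixes n :: nat
begin

definition letter_class :: "dic_gen \<times> bool \<Rightarrow> dic_gen word set" where
  "letter_class l = pres_class (dic_relations n) [l]"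

lemma word_value_letter_class:
  "word_value (Dic n) (map letter_class w) = pres_class (dic_relations n) w"
proof (induction w rule: rev_induct)
  case Nil
  show ?case by (simp add: word_value_def Dic_def presented_group_one)
next
  case (snoc l w)
  then show ?case
    by (simp add: word_value_def letter_class_def) (simp add: Dic_def presented_group_mult)
qed

text \<open>The prefixes counted by \<open>visited n w\<close> are exactly the proper prefixes of
  \<open>w @ [l]\<close>.\<close>

lemma repeats_letter_class:
  "repeats (Dic n) (map letter_class (w @ [l])) \<longleftrightarrow> dic_nf n (w @ [l]) \<in> visited n w"
proof -
  have "repeats (Dic n) (map letter_class (w @ [l])) \<longleftrightarrow>
      (\<exists>k < length (w @ [l]). dic_nf n (take k (w @ [l])) = dic_nf n (w @ [l]))"
    unfolding repeats_def take_map word_value_letter_class Dic_class_eq_iff length_map ..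
  also have "\<dots> \<longleftrightarrow> dic_nf n (w @ [l]) \<in> visited n w"
    unfolding visited_def by (force simp: image_iff less_Suc_eq_le)
  finally show ?thesis .
qed

lemma inv_letter_class: "m_inv (Dic n) (letter_class l) = letter_class (inv_letter l)"
  by (simp add: letter_class_def Dic_def presented_group_inv inv_letter_def split_beta)

lemma letter_class_moves:
  "{dic_a n, dic_x n} \<union> m_inv (Dic n) ` {dic_a n, dic_x n} = range letter_class"
proof -
  have "l \<in> {(GenA, True), (GenX, True), (GenA, False), (GenX, False)}" for l
    by (cases l; cases "fst l"; cases "snd l") auto
  then have "range letter_class =
      letter_class ` {(GenA, True), (GenX, True), (GenA, False), (GenX, False)}"
    by (intro equalityI image_mono subsetI subset_UNIV)
  also have "\<dots> = {dic_a n, dic_x n} \<union> m_inv (Dic n) ` {dic_a n, dic_x n}"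
    by (simp add: letter_class_def Dic_letters insert_commute)
  finally show ?thesis ..
qed

text \<open>Injectivity turns the ban on the group inverse of the last move into a ban on the
  inverse letter. The four normal forms one step from the identity decide it; for
  \<open>n = 1\<close> the generator \<open>a\<close> would equal its inverse.\<close>

lemma inj_letter_class:
  assumes "n \<ge> 2"
  shows "inj letter_class"
proof (rule injI)
  fix k l :: "dic_gen \<times> bool"
  assume "letter_class k = letter_class l"
  then have "dic_step n (0, False) k = dic_step n (0, False) l"
    by (simp add: letter_class_def Dic_class_eq_iff dic_nf_def)
  moreover have "(- 1) mod (2 * int n) = 2 * int n - 1" "1 mod (2 * int n) = 1"
    using assms by (simp_all add: zmod_minus1)
  ultimately show "k = l"
    using assms
    by (cases "(n, (0 :: int, False), k)" rule: dic_step.cases;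
        cases "(n, (0 :: int, False), l)" rule: dic_step.cases) (auto split: if_splits)
qed

lemma legal_move_letter_class:
  assumes "n \<ge> 2"
  shows "legal_move (Dic n) {dic_a n, dic_x n} (map letter_class w) s \<longleftrightarrow>
    (\<exists>l. s = letter_class l \<and> allowed w l)"
  using inj_letter_class[OF assms]
  unfolding legal_move_def letter_class_moves
  by (auto simp: allowed_def last_map inv_letter_class inj_eq)

lemma has_winning_strategy_if_lost:
  assumes n: "n \<ge> 2" and lost: "lost n []"
  shows "has_winning_strategy (Dic n) {dic_a n, dic_x n} Player2"
proof (rule has_winning_strategy_Player2I)
  let ?I = "\<lambda>h. \<exists>w. h = map letter_class w \<and> lost n w"
  show "?I []" using lost by simp
  fix h s
  assume "?I h" and s: "legal_move (Dic n) {dic_a n, dic_x n} h s"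
  then obtain w where h: "h = map letter_class w" and w: "lost n w" by blast
  from s obtain l where l: "s = letter_class l" "allowed w l"
    unfolding h legal_move_letter_class[OF n] by blast
  from w l have "answered n w l" unfolding lost_iff_answered[of n w] by blast
  then obtain l' where
    new: "dic_nf n (w @ [l]) \<notin> visited n w" and l': "l' \<noteq> inv_letter l" and
    or: "dic_nf n ((w @ [l]) @ [l']) \<in> visited n (w @ [l]) \<or> lost n ((w @ [l]) @ [l'])"
    unfolding answered_def append_assoc append_Cons append_Nil by blast
  have "\<not> repeats (Dic n) (h @ [s])"
    using new repeats_letter_class[of w l] by (simp add: h l)
  moreover have "allowed (w @ [l]) l'" using l' by (simp add: allowed_def)
  then have "legal_move (Dic n) {dic_a n, dic_x n} (map letter_class (w @ [l])) (letter_class l')"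
    unfolding legal_move_letter_class[OF n] by blast
  then have "legal_move (Dic n) {dic_a n, dic_x n} (h @ [s]) (letter_class l')"
    by (simp add: h l)
  moreover have "repeats (Dic n) (h @ [s, letter_class l']) \<or> ?I (h @ [s, letter_class l'])"
    using or unfolding repeats_letter_class[symmetric]
    by (auto simp: h l intro!: exI[of _ "w @ [l, l']"])
  ultimately show "\<not> repeats (Dic n) (h @ [s]) \<and>
      (\<exists>t. legal_move (Dic n) {dic_a n, dic_x n} (h @ [s]) t \<and>
        (repeats (Dic n) (h @ [s, t]) \<or> ?I (h @ [s, t])))"
    by blast
qed

end

section \<open>Corridors\<close>

text \<open>The Boolean component of a normal form is called its level. A corridor is a strip of columns
  \<open>0, \<dots>, m\<close> of the Cayley graph, traversed at level \<open>lv\<close> by the letter \<open>(GenA, f)\<close>. Column \<open>i\<close> is the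
  coset \<open>{vtx i \<tau> j | \<tau> j}\<close> of \<open>\<langle>x\<rangle>\<close>; the flag \<open>\<tau>\<close> records the factor \<open>a\<^sup>n\<close>.\<close>

locale corridor =
  fixes n :: nat and u :: int and f lv :: bool and m :: int
  assumes m_pos: "0 < m" and m_less: "m < int n" and m_even: "even m"
begin

definition vtx :: "int \<Rightarrow> bool \<Rightarrow> bool \<Rightarrow> int \<times> bool" where
  "vtx i \<tau> j =
     ((u + (if f = lv then - i else i) + (if \<tau> then int n else 0)) mod (2 * int n), j)"

lemma step_forward [simp]: "dic_step n (vtx i \<tau> lv) (GenA, f) = vtx (i + 1) \<tau> lv"
  by (auto simp: vtx_def mod_simps algebra_simps)

lemma step_back [simp]: "dic_step n (vtx i \<tau> lv) (GenA, \<not> f) = vtx (i - 1) \<tau> lv"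
  by (auto simp: vtx_def mod_simps algebra_simps)

lemma step_x [simp]: "dic_step n (vtx i \<tau> j) (GenX, b) = vtx i (\<tau> \<noteq> (b = j)) (\<not> j)"
proof -
  have "(y + int n + int n) mod (2 * int n) = y mod (2 * int n)" for y
    using mod_add_self2[of y "2 * int n"] by (simp add: algebra_simps)
  then show ?thesis by (auto simp: vtx_def mod_simps)
qed

lemma step_xx:
  "dic_step n (dic_step n (vtx i \<tau> j) (GenX, b)) (GenX, b) = vtx i (\<not> \<tau>) j"
proof -
  have "((\<tau> \<noteq> (b = j)) \<noteq> (b = (\<not> j))) = (\<not> \<tau>)" by blast
  then show ?thesis by (simp only: step_x not_not)
qed

lemma vtx_level_neq [simp]: "vtx i \<tau> True \<noteq> vtx i' \<tau>' False" "vtx i \<tau> False \<noteq> vtx i' \<tau>' True"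
  by (simp_all add: vtx_def)

text \<open>Equal exponents modulo \<open>2 * n\<close> differ by a multiple of \<open>2 * n\<close>
  that is too small to be nonzero. The flags contribute \<open>0\<close> or \<open>n\<close> up to
  sign, so columns less than \<open>n\<close> apart must coincide.\<close>

lemma vtx_eq_iff [simp]:
  assumes "i < i' + int n" "i' < i + int n"
  shows "vtx i \<tau> j = vtx i' \<tau>' j' \<longleftrightarrow> i = i' \<and> \<tau> = \<tau>' \<and> j = j'"
proof
  assume eq: "vtx i \<tau> j = vtx i' \<tau>' j'"
  let ?d = "(if f = lv then i' - i else i - i') +
    ((if \<tau> then int n else 0) - (if \<tau>' then int n else 0))"
  have "2 * int n dvd ?d"
    using eq by (auto simp: vtx_def mod_eq_dvd_iff algebra_simps split: if_splits)
  moreover have "\<bar>?d\<bar> < 2 * int n" using assms by auto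
  ultimately have "?d = 0" by (metis abs_of_nat dvd_imp_le_int abs_mult abs_numeral not_le)
  then show "i = i' \<and> \<tau> = \<tau>' \<and> j = j'"
    using assms eq by (auto simp: vtx_def split: if_splits)
qed simp

text \<open>In an even column the path has passed straight on, at \<open>\<rho>\<close>; in an odd column it has either passed
  straight on or made two \<open>x\<close>-steps. A player who re-enters column \<open>0\<close> from column \<open>1\<close> loses at once.\<close>

definition explored :: "(int \<times> bool) set \<Rightarrow> int \<Rightarrow> bool" where
  "explored V e \<longleftrightarrow>
     (\<forall>i. even i \<and> 0 \<le> i \<and> i < e \<longrightarrow> (\<exists>\<rho>. vtx i \<rho> lv \<in> V \<and> vtx i (\<not> \<rho>) lv \<notin> V \<and>
        vtx (i + 1) \<rho> lv \<in> V \<and> (0 < i \<longrightarrow> vtx (i - 1) \<rho> lv \<in> V))) \<and>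
     (\<forall>i \<tau> \<tau>'. odd i \<and> 0 < i \<and> i < e \<and> vtx i \<tau> lv \<notin> V \<longrightarrow> vtx i \<tau>' (\<not> lv) \<notin> V) \<and>
     (\<forall>\<tau>. vtx 0 \<tau> lv \<notin> V \<longrightarrow> (\<exists>l. l \<noteq> (GenA, f) \<and> dic_step n (vtx 0 \<tau> lv) l \<in> V))"

text \<open>The last clause makes entering column \<open>m\<close> a losing move, as the last clause
  of \<open>explored\<close> does for column \<open>0\<close>. Column \<open>m\<close> is exempt at
  level \<open>\<not> lv\<close>, since the origin may lie there.\<close>

definition unexplored :: "(int \<times> bool) set \<Rightarrow> int \<Rightarrow> bool" where
  "unexplored V k \<longleftrightarrow>
     (\<forall>i \<tau>. k < i \<and> i \<le> m \<longrightarrow> vtx i \<tau> lv \<notin> V) \<and>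
     (\<forall>i \<tau>. k < i \<and> i < m \<longrightarrow> vtx i \<tau> (\<not> lv) \<notin> V) \<and>
     (\<forall>\<tau>. \<exists>l. l \<noteq> (GenA, \<not> f) \<and> dic_step n (vtx m \<tau> lv) l \<in> V)"

text \<open>This is the position after an advance along the strip: the current vertex is the only
  visited one in its column. Parity of \<open>k\<close> against \<open>m\<close> decides who must
  enter the last column.\<close>

definition fresh :: "dic_gen word \<Rightarrow> int \<Rightarrow> bool \<Rightarrow> bool" where
  "fresh w k \<sigma> \<longleftrightarrow> odd k \<and> 0 < k \<and> k < m \<and> explored (visited n w) k \<and> unexplored (visited n w) k \<and>
     dic_nf n w = vtx k \<sigma> lv \<and> w \<noteq> [] \<and> last w = (GenA, f) \<and>
     vtx k (\<not> \<sigma>) lv \<notin> visited n w \<and> (\<forall>\<tau>. vtx k \<tau> (\<not> lv) \<notin> visited n w)"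

section \<open>Explored and unexplored columns as the path grows\<close>

lemma explored_even:
  assumes "explored V e" "even i" "0 \<le> i" "i < e"
  obtains \<rho> where "vtx i \<rho> lv \<in> V" "vtx i (\<not> \<rho>) lv \<notin> V" "vtx (i + 1) \<rho> lv \<in> V"
    "0 < i \<Longrightarrow> vtx (i - 1) \<rho> lv \<in> V"
  using assms unfolding explored_def by blast

lemma explored_odd:
  "explored V e \<Longrightarrow> odd i \<Longrightarrow> 0 < i \<Longrightarrow> i < e \<Longrightarrow> vtx i \<tau> lv \<notin> V \<Longrightarrow> vtx i \<tau>' (\<not> lv) \<notin> V"
  unfolding explored_def by blast

text \<open>The positive claims survive any insertion; the negative ones concern columns below
  \<open>e\<close>, all distinct from column \<open>c\<close> because
  \<open>c < int n\<close>.\<close>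

lemma explored_insert:
  assumes "explored V e" "e \<le> c" "c < int n"
  shows "explored (insert (vtx c \<tau> j) V) e"
proof -
  have new: "vtx i \<tau>' j' \<noteq> vtx c \<tau> j" if "0 \<le> i" "i < e" for i \<tau>' j'
    using that assms(2,3) by simp
  show ?thesis
    unfolding explored_def
  proof (intro conjI allI impI)
    fix i assume i: "even i \<and> 0 \<le> i \<and> i < e"
    then obtain \<rho> where "vtx i \<rho> lv \<in> V" "vtx i (\<not> \<rho>) lv \<notin> V" "vtx (i + 1) \<rho> lv \<in> V"
      "0 < i \<Longrightarrow> vtx (i - 1) \<rho> lv \<in> V"
      using explored_even[OF assms(1)] by blast
    then show "\<exists>\<rho>. vtx i \<rho> lv \<in> insert (vtx c \<tau> j) V \<and> vtx i (\<not> \<rho>) lv \<notin> insert (vtx c \<tau> j) V \<and>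
        vtx (i + 1) \<rho> lv \<in> insert (vtx c \<tau> j) V \<and> (0 < i \<longrightarrow> vtx (i - 1) \<rho> lv \<in> insert (vtx c \<tau> j) V)"
      using i new by blast
  next
    fix i \<tau>1 \<tau>2
    assume "odd i \<and> 0 < i \<and> i < e \<and> vtx i \<tau>1 lv \<notin> insert (vtx c \<tau> j) V"
    then show "vtx i \<tau>2 (\<not> lv) \<notin> insert (vtx c \<tau> j) V"
      using explored_odd[OF assms(1), of i \<tau>1 \<tau>2] new[of i] by auto
  next
    fix \<tau>' assume "vtx 0 \<tau>' lv \<notin> insert (vtx c \<tau> j) V"
    then show "\<exists>l. l \<noteq> (GenA, f) \<and> dic_step n (vtx 0 \<tau>' lv) l \<in> insert (vtx c \<tau> j) V"
      using assms(1) unfolding explored_def by blast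
  qed
qed

lemma explored_mono: "explored V e \<Longrightarrow> e' \<le> e \<Longrightarrow> explored V e'"
  unfolding explored_def by (meson order_less_le_trans)

lemma unexplored_insert:
  assumes "unexplored V k" "0 \<le> c" "c \<le> k"
  shows "unexplored (insert (vtx c \<tau> j) V) k"
proof -
  have new: "vtx i \<tau>' j' \<noteq> vtx c \<tau> j" if "k < i" "i \<le> m" for i \<tau>' j'
    using that assms(2,3) m_less by simp
  show ?thesis
    using assms(1) new unfolding unexplored_def by (meson insert_iff less_imp_le)
qed

lemma unexplored_mono: "unexplored V k \<Longrightarrow> k \<le> k' \<Longrightarrow> unexplored V k'"
  unfolding unexplored_def by (meson order_le_less_trans)

lemma letter_cases:
  obtains (fwd) "l = (GenA, f)" | (bwd) "l = (GenA, \<not> f)" | (x) b where "l = (GenX, b)"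
proof (cases l)
  case (Pair g b)
  then show ?thesis using that by (cases g; cases "b = f") auto
qed

text \<open>The player to move stands in column \<open>e\<close> next to the earlier path, which came through
  \<open>vtx e (\<not> \<sigma>) lv\<close>. Walking back runs alongside that path, and the opponent is the one to
  reach a column that the path has crossed by \<open>x\<close>-steps, or column \<open>0\<close>.\<close>

lemma lost_return:
  assumes "odd e" "0 < e" "e < m" "explored (visited n w) e"
    and "dic_nf n w = vtx e \<sigma> lv"
    and "vtx e (\<not> \<sigma>) lv \<in> visited n w" "vtx (e - 1) \<sigma> lv \<notin> visited n w"
    and "\<And>b. allowed w (GenX, b) \<Longrightarrow> vtx e (\<sigma> \<noteq> (b = lv)) (\<not> lv) \<notin> visited n w"
    and "allowed w (GenA, f) \<Longrightarrow> answered n w (GenA, f)"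
  shows "lost n w"
  using assms
proof (induction "nat e" arbitrary: e w rule: less_induct)
  case less
  note e = less.prems(1-3) and V = less.prems(4) and nf [simp] = less.prems(5)
  have "answered n w l" if l: "allowed w l" for l
  proof (cases l rule: letter_cases)
    case fwd
    with l less.prems(9) show ?thesis by simp
  next
    case (x b)
    show ?thesis unfolding x
    proof (rule answeredI)
      show "dic_step n (dic_nf n w) (GenX, b) \<notin> visited n w"
        using l less.prems(8) by (simp add: x)
      show "dic_step n (dic_step n (dic_nf n w) (GenX, b)) (GenX, b) \<in> visited n w \<or>
          lost n (w @ [(GenX, b), (GenX, b)])"
        \<comment> \<open>Repeating \<open>x\<close> flips the flag and so lands on the earlier path
          in the same column.\<close>
        unfolding nf step_xx using less.prems(6) ..
    qed (simp add: inv_letter_def)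
  next
    case bwd
    have "\<exists>l'. l' \<noteq> inv_letter l \<and>
       (dic_nf n (w @ [l, l']) \<in> visited n (w @ [l]) \<or> lost n (w @ [l, l']))"
    proof (cases "e = 1")
      \<comment> \<open>The back step enters column \<open>0\<close>, where the last clause of
        \<open>explored\<close> supplies the closing letter.\<close>
      case True
      then have "vtx 0 \<sigma> lv \<notin> visited n w" using less.prems(7) by simp
      then obtain l' where "l' \<noteq> (GenA, f)" "dic_step n (vtx 0 \<sigma> lv) l' \<in> visited n w"
        using V unfolding explored_def by blast
      with True show ?thesis
        unfolding bwd by (intro exI[of _ l']) (simp add: inv_letter_def)
    next
      case False
      with e have e3: "e \<ge> 3" by presburger
      let ?w = "w @ [l, l]"
      have "vtx (e - 2) \<sigma> lv \<in> visited n w \<or> lost n ?w"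
      proof (rule disjCI)
        assume nl: "\<not> lost n ?w"
        show "vtx (e - 2) \<sigma> lv \<in> visited n w"
        proof (rule ccontr)
          assume new: "vtx (e - 2) \<sigma> lv \<notin> visited n w"
          have vis: "visited n ?w =
              insert (vtx (e - 2) \<sigma> lv) (insert (vtx (e - 1) \<sigma> lv) (visited n w))"
            by (simp add: bwd)
          \<comment> \<open>The even column \<open>e - 1\<close> was crossed with one flag only.
            That flag is \<open>\<not> \<sigma>\<close>, so the earlier path also came through
            column \<open>e - 2\<close> with it.\<close>
          obtain \<rho> where \<rho>: "vtx (e - 1) \<rho> lv \<in> visited n w" "vtx (e - 2) \<rho> lv \<in> visited n w"
            using explored_even[OF V, of "e - 1"] e e3 by auto
          with less.prems(7) have "\<rho> = (\<not> \<sigma>)" by (cases \<rho>; cases \<sigma>) auto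
          with \<rho> have opp: "vtx (e - 2) (\<not> \<sigma>) lv \<in> visited n w" by simp
          \<comment> \<open>Likewise the crossing of column \<open>e - 3\<close> cannot have used
            \<open>\<sigma>\<close>, because it continued into column \<open>e - 2\<close>, where
            \<open>\<sigma>\<close> is unvisited.\<close>
          obtain \<rho>' where "vtx (e - 3) (\<not> \<rho>') lv \<notin> visited n w" "vtx (e - 2) \<rho>' lv \<in> visited n w"
            using explored_even[OF V, of "e - 3"] e e3 by auto
          with new have behind: "vtx (e - 3) \<sigma> lv \<notin> visited n w" by (cases \<rho>'; cases \<sigma>) auto
          have "lost n ?w"
          proof (rule less.hyps[of "e - 2"])
            show "explored (visited n ?w) (e - 2)"
              unfolding vis using V e m_less
              by (intro explored_insert) (auto intro: explored_mono)
            show "dic_nf n ?w = vtx (e - 2) \<sigma> lv" by (simp add: bwd)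
            show "vtx (e - 2) (\<not> \<sigma>) lv \<in> visited n ?w" unfolding vis using opp by simp
            show "vtx (e - 2 - 1) \<sigma> lv \<notin> visited n ?w"
              unfolding vis using behind e m_less by simp
            \<comment> \<open>An unvisited vertex at level \<open>lv\<close> shows that the odd
              column \<open>e - 2\<close> was passed straight, so its other level is empty.\<close>
            show "vtx (e - 2) (\<sigma> \<noteq> (b = lv)) (\<not> lv) \<notin> visited n ?w" for b
              unfolding vis using explored_odd[OF V _ _ _ new] e e3 m_less by simp
            show "answered n ?w (GenA, f)" if "allowed ?w (GenA, f)"
              using that by (simp add: allowed_def inv_letter_def bwd)
          qed (use e e3 in auto)
          with nl show False ..
        qed
      qed
      then show ?thesis
        unfolding bwd by (intro exI[of _ "(GenA, \<not> f)"]) (auto simp: inv_letter_def)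
    qed
    then show ?thesis using less.prems(7) by (simp add: answered_def bwd)
  qed
  then show ?case by (simp add: lost_iff_answered[of n w])
qed

text \<open>The answer is a second forward step or, in column \<open>m\<close>, the closing letter
  from \<open>unexplored\<close>. The alternatives in \<open>col\<close> match the two ways of
  leaving an odd column, after two \<open>x\<close>-steps or straight on; either gives the odd
  clause of \<open>explored\<close> for column \<open>k\<close>. The assumption \<open>lost\<close>
  is the place for the induction hypothesis of \<open>lost_fresh\<close>.\<close>

lemma answered_forward:
  assumes k: "odd k" "0 < k" "k < m"
    and V: "explored (visited n w) k" "unexplored (visited n w) k"
    and nf [simp]: "dic_nf n w = vtx k \<sigma> lv"
    and col: "(\<forall>\<tau>. vtx k \<tau> lv \<in> visited n w) \<or> (\<forall>\<tau>. vtx k \<tau> (\<not> lv) \<notin> visited n w)"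
    and lost: "\<And>w'. fresh w' (k + 2) \<sigma> \<Longrightarrow> lost n w'"
  shows "answered n w (GenA, f)"
proof -
  let ?F = "(GenA, f)" and ?V = "visited n w"
  have new: "vtx (k + 1) \<tau> lv \<notin> ?V" for \<tau>
    using V(2) k unfolding unexplored_def by auto
  have "\<exists>l'. l' \<noteq> (GenA, \<not> f) \<and>
     (dic_step n (vtx (k + 1) \<sigma> lv) l' \<in> ?V \<or> lost n (w @ [?F, l']))"
  proof (cases "k + 1 = m")
    case True
    then show ?thesis using V(2) unfolding unexplored_def by blast
  next
    case False
    \<comment> \<open>Since \<open>k\<close> is odd and \<open>m\<close> even, a double step cannot
      jump into or past column \<open>m\<close>.\<close>
    with k m_even have k2: "k + 2 < m" by presburger
    let ?w = "w @ [?F, ?F]"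
    let ?V1 = "insert (vtx (k + 1) \<sigma> lv) ?V"
    have vis: "visited n ?w = insert (vtx (k + 2) \<sigma> lv) ?V1" by (simp add: add.commute)
    have cur: "vtx k \<sigma> lv \<in> ?V" using dic_nf_in_visited[of n w] by simp
    have "explored (visited n ?w) (k + 2)"
    proof -
      have old: "explored (visited n ?w) k"
        unfolding vis using V(1) k2 m_less by (intro explored_insert) auto
      show ?thesis
        unfolding explored_def
      proof (intro conjI allI impI)
        fix i assume i: "even i \<and> 0 \<le> i \<and> i < k + 2"
        show "\<exists>\<rho>. vtx i \<rho> lv \<in> visited n ?w \<and> vtx i (\<not> \<rho>) lv \<notin> visited n ?w \<and>
            vtx (i + 1) \<rho> lv \<in> visited n ?w \<and> (0 < i \<longrightarrow> vtx (i - 1) \<rho> lv \<in> visited n ?w)"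
        proof (cases "i < k")
          case True
          then show ?thesis using i old unfolding explored_def by blast
        next
          case False
          \<comment> \<open>The only new even column is crossed with flag \<open>\<sigma>\<close>,
            and both its neighbours on the path carry that flag.\<close>
          with i k have "i = k + 1" by presburger
          then show ?thesis using cur new k2 k m_less by (auto simp: vis intro!: exI[of _ \<sigma>])
        qed
      next
        fix i \<tau> \<tau>' assume i: "odd i \<and> 0 < i \<and> i < k + 2 \<and> vtx i \<tau> lv \<notin> visited n ?w"
        show "vtx i \<tau>' (\<not> lv) \<notin> visited n ?w"
        proof (cases "i < k")
          case True
          then show ?thesis using i explored_odd[OF old] by blast
        next
          case False
          moreover have "odd i" "i < k + 2" using i by auto
          ultimately have "i = k" using k by presburger
          then show ?thesis unfolding vis using i col k2 k m_less by auto
        qed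
      next
        fix \<tau> assume "vtx 0 \<tau> lv \<notin> visited n ?w"
        then show "\<exists>l. l \<noteq> (GenA, f) \<and> dic_step n (vtx 0 \<tau> lv) l \<in> visited n ?w"
          using old unfolding explored_def by blast
      qed
    qed
    moreover have "unexplored (visited n ?w) (k + 2)"
      unfolding vis using V(2) k by (intro unexplored_insert) (auto intro: unexplored_mono)
    moreover have "vtx (k + 2) (\<not> \<sigma>) lv \<notin> visited n ?w"
      unfolding vis using V(2) k k2 m_less unfolding unexplored_def by auto
    moreover have "vtx (k + 2) \<tau> (\<not> lv) \<notin> visited n ?w" for \<tau>
      unfolding vis using V(2) k k2 m_less unfolding unexplored_def by auto
    ultimately have "fresh ?w (k + 2) \<sigma>"
      using k k2 by (auto simp: fresh_def add.commute)
    then show ?thesis using lost by (auto intro!: exI[of _ ?F])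
  qed
  then show ?thesis using new by (auto simp: answered_def inv_letter_def)
qed

text \<open>Induction on the columns still ahead. A forward step is doubled; an
  \<open>x\<close>-step is doubled too, which moves to the other flag in the same column and leaves
  the choice between going on (\<open>answered_forward\<close>) and turning back
  (\<open>lost_return\<close>).\<close>

lemma lost_fresh:
  assumes "fresh w k \<sigma>"
  shows "lost n w"
  using assms
proof (induction "nat (m - k)" arbitrary: k \<sigma> w rule: less_induct)
  case less
  have k: "odd k" "0 < k" "k < m"
    and V: "explored (visited n w) k" "unexplored (visited n w) k"
    and nf [simp]: "dic_nf n w = vtx k \<sigma> lv"
    and last: "w \<noteq> []" "last w = (GenA, f)"
    and opp: "vtx k (\<not> \<sigma>) lv \<notin> visited n w"
    and up: "\<And>\<tau>. vtx k \<tau> (\<not> lv) \<notin> visited n w"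
    using less.prems unfolding fresh_def by auto
  have IH: "lost n w'" if "fresh w' (k + 2) \<sigma>'" for w' \<sigma>'
    using less.hyps[OF _ that] k by simp
  have cur: "vtx k \<sigma> lv \<in> visited n w" using dic_nf_in_visited[of n w] by simp
  have "answered n w l" if l: "allowed w l" for l
  proof (cases l rule: letter_cases)
    case fwd
    then show ?thesis using up by (auto intro!: answered_forward[OF k V nf] IH)
  next
    case bwd
    then show ?thesis using l last by (simp add: allowed_def inv_letter_def)
  next
    case (x b)
    let ?w = "w @ [l, l]"
    let ?q = "vtx k (\<sigma> \<noteq> (b = lv)) (\<not> lv)"
    have vis: "visited n ?w = insert (vtx k (\<not> \<sigma>) lv) (insert ?q (visited n w))"
      unfolding x visited_snoc2 nf step_xx unfolding step_x ..
    have E: "explored (visited n ?w) k"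
      unfolding vis using V k m_less by (intro explored_insert) auto
    have U: "unexplored (visited n ?w) k"
      unfolding vis using V k by (intro unexplored_insert) auto
    have nf': "dic_nf n ?w = vtx k (\<not> \<sigma>) lv"
      unfolding x dic_nf_snoc2 nf step_xx ..
    have "lost n ?w"
    proof (rule lost_return[OF k E nf'])
      show "vtx k (\<not> \<not> \<sigma>) lv \<in> visited n ?w" unfolding vis using cur by simp
      \<comment> \<open>The path entered column \<open>k\<close> with flag \<open>\<sigma>\<close>,
        so column \<open>k - 1\<close> is unvisited at the opposite flag, which is the lane for
        walking back.\<close>
      obtain \<rho> where "vtx (k - 1) (\<not> \<rho>) lv \<notin> visited n w" "vtx k \<rho> lv \<in> visited n w"
        using explored_even[OF V(1), of "k - 1"] k by auto
      with opp have "vtx (k - 1) (\<not> \<sigma>) lv \<notin> visited n w" by (cases \<rho>; cases \<sigma>) auto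
      then show "vtx (k - 1) (\<not> \<sigma>) lv \<notin> visited n ?w"
        unfolding vis using k m_less by simp
      \<comment> \<open>Only a third \<open>x\<close> of the same sign is allowed; it reaches the
        remaining vertex of the column.\<close>
      show "vtx k ((\<not> \<sigma>) \<noteq> (b' = lv)) (\<not> lv) \<notin> visited n ?w" if "allowed ?w (GenX, b')" for b'
        using that up k m_less by (auto simp: vis allowed_def inv_letter_def x)
      show "answered n ?w (GenA, f)"
      proof (rule answered_forward[OF k E U nf' _ IH])
        have "vtx k \<tau> lv \<in> visited n ?w" for \<tau>
          unfolding vis using cur by (cases "\<tau> = \<sigma>") auto
        then show "(\<forall>\<tau>. vtx k \<tau> lv \<in> visited n ?w) \<or> (\<forall>\<tau>. vtx k \<tau> (\<not> lv) \<notin> visited n ?w)" by blast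
      qed
    qed
    then show ?thesis
      using up by (auto simp: answered_def inv_letter_def x intro!: exI[of _ "(GenX, b)"])
  qed
  then show ?case by (simp add: lost_iff_answered[of n w])
qed

text \<open>Columns are cosets and hence periodic modulo \<open>n\<close>; going once around flips
  the flag. This identifies visited columns behind the start with columns at the far end of the
  strip.\<close>

lemma vtx_antipode: "vtx (i + int n) \<tau> j = vtx i (\<not> \<tau>) j"
proof -
  have "(y + int n + int n) mod (2 * int n) = y mod (2 * int n)"
    "(y - int n + int n) mod (2 * int n) = y mod (2 * int n)"
    "(y - int n) mod (2 * int n) = (y + int n) mod (2 * int n)" for y
    using mod_add_self2[of y "2 * int n"] mod_add_self2[of "y - int n" "2 * int n"]
    by (simp_all add: algebra_simps)
  from this[of "u + i"] this[of "u - i"] show ?thesis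
    by (auto simp: vtx_def algebra_simps)
qed

end

section \<open>The opening\<close>

lemma dic_nf_straight:
  "dic_nf n (replicate c (GenA, f)) = ((if f then int c else - int c) mod (2 * int n), False)"
proof (induction c)
  case (Suc c)
  have "replicate (Suc c) (GenA, f) = replicate c (GenA, f) @ [(GenA, f)]"
    by (simp add: replicate_append_same)
  moreover have eq: "- int (Suc c) = - int c - 1" "int (Suc c) = int c + 1" by simp_all
  ultimately show ?case
    using Suc by (cases f) (simp_all only: eq dic_nf_snoc dic_step.simps mod_simps if_True if_False simp_thms)
qed simp

lemma visited_straight:
  "visited n (replicate c (GenA, f)) =
     (\<lambda>i. ((if f then int i else - int i) mod (2 * int n), False)) ` {..c}"
  by (auto simp: visited_def dic_nf_straight min_def)

text \<open>The corridor starts in the column of the turn and ends in the column of the origin.\<close>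

lemma lost_straight_turn:
  assumes n: "even n" and c: "even c" "2 \<le> c" "c + 2 \<le> n"
  shows "lost n (replicate c (GenA, f) @ [(GenX, b), (GenA, \<not> f)])"
proof -
  define u where "u = (if f then int c else - int c)"
  \<comment> \<open>At level \<open>True\<close> the letters of \<open>a\<close> act in reverse, so
    \<open>(GenA, \<not> f)\<close> continues in the direction of the straight walk.\<close>
  interpret corridor n u "\<not> f" True "int n - int c"
    using assms by unfold_locales auto
  let ?w = "replicate c (GenA, f)" and ?\<sigma> = "\<not> b"
  let ?w' = "?w @ [(GenX, b), (GenA, \<not> f)]"
  have straight: "((if f then int i else - int i) mod (2 * int n), False) = vtx (int i - int c) False False" for i
    unfolding vtx_def unfolding u_def by auto
  have nf: "dic_nf n ?w = vtx 0 False False"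
    using straight[of c] by (simp add: dic_nf_straight)
  have sx: "dic_step n (vtx 0 False False) (GenX, b) = vtx 0 ?\<sigma> True" by simp
  have sf: "dic_step n (vtx 0 ?\<sigma> True) (GenA, \<not> f) = vtx 1 ?\<sigma> True"
    using step_forward[of 0 ?\<sigma>] by simp
  have vis: "visited n ?w' = insert (vtx 1 ?\<sigma> True) (insert (vtx 0 ?\<sigma> True)
      ((\<lambda>i. vtx (int i - int c) False False) ` {..c}))"
    unfolding visited_snoc2 nf sx sf visited_straight straight ..
  have start: "vtx (- int c) False False \<in> visited n ?w'"
    unfolding vis by (intro insertI2 image_eqI[where x = 0]) auto
  have turn: "vtx 0 False False \<in> visited n ?w'"
    unfolding vis by (intro insertI2 image_eqI[where x = c]) auto
  have "explored (visited n ?w') 1"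
    unfolding explored_def
  proof (intro conjI allI impI)
    fix i :: int assume "even i \<and> 0 \<le> i \<and> i < 1"
    then have "i = 0" by simp
    then show "\<exists>\<rho>. vtx i \<rho> True \<in> visited n ?w' \<and> vtx i (\<not> \<rho>) True \<notin> visited n ?w' \<and>
        vtx (i + 1) \<rho> True \<in> visited n ?w' \<and> (0 < i \<longrightarrow> vtx (i - 1) \<rho> True \<in> visited n ?w')"
      unfolding vis using c by (intro exI[of _ ?\<sigma>]) auto
  next
    show "\<exists>l. l \<noteq> (GenA, \<not> f) \<and> dic_step n (vtx 0 \<tau> True) l \<in> visited n ?w'" for \<tau>
      \<comment> \<open>With this sign the \<open>x\<close>-step reaches the vertex of the turn for
        either flag.\<close>
      using turn by (intro exI[of _ "(GenX, \<tau>)"]) simp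
  qed auto
  moreover have "unexplored (visited n ?w') 1"
    unfolding unexplored_def
  proof (intro conjI allI impI)
    show "vtx i \<tau> True \<notin> visited n ?w'" if "1 < i \<and> i \<le> int n - int c" for i \<tau>
      unfolding vis using that c by auto
    show "vtx i \<tau> (\<not> True) \<notin> visited n ?w'" if "1 < i \<and> i < int n - int c" for i \<tau>
      unfolding vis using that c by auto
    \<comment> \<open>The origin, at column \<open>- c\<close>, reappears in the last column, where
      a suitable \<open>x\<close>-step hits it for either flag.\<close>
    have "vtx (int n - int c) True False = vtx (- int c) False False"
      using vtx_antipode[of "- int c" True False] by simp
    then show "\<exists>l. l \<noteq> (GenA, \<not> \<not> f) \<and> dic_step n (vtx (int n - int c) \<tau> True) l \<in> visited n ?w'" for \<tau>
      using start by (intro exI[of _ "(GenX, \<not> \<tau>)"]) simp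
  qed
  ultimately have "fresh ?w' 1 ?\<sigma>"
    unfolding fresh_def dic_nf_snoc2 nf sx sf vis using c by auto
  then show ?thesis by (rule lost_fresh)
qed

text \<open>Induction on the distance to closing the cycle of \<open>a\<close>: parity lets the
  opponent complete \<open>2 * n\<close> steps. A turn before \<open>a^n\<close> is met by the
  corridor of \<open>lost_straight_turn\<close>; from \<open>a^n\<close> on, a doubled
  \<open>x\<close> falls back onto the walk.\<close>

lemma lost_straight:
  assumes "even n" "even c" "2 \<le> c" "c + 2 \<le> 2 * n"
  shows "lost n (replicate c (GenA, f))"
  using assms
proof (induction "2 * n - c" arbitrary: c rule: less_induct)
  case less
  let ?w = "replicate c (GenA, f)"
  have app: "?w @ [(GenA, f), (GenA, f)] = replicate (c + 2) (GenA, f)"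
    by (simp add: numeral_2_eq_2 replicate_app_Cons_same)
  have "answered n ?w l" if l: "allowed ?w l" for l
  proof -
    obtain g b where gb: "l = (g, b)" by force
    show ?thesis
    proof (cases g)
      case GenA
      with gb l less.prems have l: "l = (GenA, f)" by (auto simp: allowed_def inv_letter_def)
      show ?thesis unfolding l
      proof (rule answeredI)
        have nf1: "dic_step n (dic_nf n ?w) (GenA, f) =
            ((if f then int (c + 1) else - int (c + 1)) mod (2 * int n), False)"
          using dic_nf_straight[of n "c + 1" f] dic_nf_snoc[of n ?w "(GenA, f)"]
          by (simp add: replicate_append_same del: dic_nf_snoc)
        have nf2: "dic_step n (dic_step n (dic_nf n ?w) (GenA, f)) (GenA, f) =
            ((if f then int (c + 2) else - int (c + 2)) mod (2 * int n), False)"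
          using dic_nf_straight[of n "c + 2" f] dic_nf_snoc2[of n ?w "(GenA, f)" "(GenA, f)"]
          by (simp only: app)
        have "(if f then int (c + 1) else - int (c + 1)) mod (2 * int n) \<noteq>
            (if f then int i else - int i) mod (2 * int n)" if "i \<le> c" for i
        proof
          assume "(if f then int (c + 1) else - int (c + 1)) mod (2 * int n) =
            (if f then int i else - int i) mod (2 * int n)"
          then have "2 * int n dvd (if f then int (c + 1) - int i else - (int (c + 1) - int i))"
            by (auto simp: mod_eq_dvd_iff algebra_simps split: if_splits)
          then have "2 * int n dvd int (c + 1) - int i" by (metis dvd_minus_iff)
          then have "2 * int n \<le> int (c + 1) - int i"
            by (rule zdvd_imp_le) (use that in auto)
          with less.prems show False by simp
        qed
        then show "dic_step n (dic_nf n ?w) (GenA, f) \<notin> visited n ?w"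
          unfolding nf1 visited_straight by blast
        show "dic_step n (dic_step n (dic_nf n ?w) (GenA, f)) (GenA, f) \<in> visited n ?w \<or>
            lost n (?w @ [(GenA, f), (GenA, f)])"
        proof (cases "c + 2 = 2 * n")
          case True
          then have "int (c + 2) = 2 * int n" by simp
          then show ?thesis
            unfolding nf2 by (auto simp: visited_straight image_iff intro!: bexI[of _ 0])
        next
          case False
          with less.prems have "c + 2 + 2 \<le> 2 * n" by presburger
          then show ?thesis unfolding app using less.hyps[of "c + 2"] less.prems by simp
        qed
      qed (simp add: inv_letter_def)
    next
      case GenX
      with gb have l: "l = (GenX, b)" by simp
      have new: "dic_step n (dic_nf n ?w) (GenX, b) \<notin> visited n ?w"
        by (auto simp: dic_nf_straight visited_straight)
      show ?thesis
      proof (cases "c < n")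
        case True
        with less.prems have "c + 2 \<le> n" by presburger
        then show ?thesis
          unfolding l using new less.prems
          by (intro answeredI[where l' = "(GenA, \<not> f)"] disjI2 lost_straight_turn)
            (auto simp: inv_letter_def)
      next
        case False
        have shift: "(if f then int c else - int c) + int n =
            (if f then int (c - n) else - int (c - n)) + (if f then 2 * int n else 0)"
          using False by (cases f) simp_all
        have "dic_step n (dic_step n (dic_nf n ?w) (GenX, b)) (GenX, b) =
            (((if f then int c else - int c) + int n) mod (2 * int n), False)"
          by (cases b) (auto simp: dic_nf_straight mod_simps)
        also have "\<dots> = ((if f then int (c - n) else - int (c - n)) mod (2 * int n), False)"
          unfolding shift by (cases f) simp_all
        also have "\<dots> \<in> visited n ?w" by (auto simp: visited_straight)
        finally show ?thesis
          unfolding l using new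
          by (intro answeredI[where l' = "(GenX, b)"] disjI1) (auto simp: inv_letter_def)
      qed
    qed
  qed
  then show ?case by (simp add: lost_iff_answered[of n ?w])
qed

text \<open>The corridor consists of all columns but that of the origin.\<close>

lemma lost_xx_straight:
  assumes n: "even n" "4 \<le> n"
  shows "lost n [(GenX, b), (GenX, b), (GenA, f), (GenA, f)]"
proof -
  \<comment> \<open>Column \<open>0\<close> is one step beyond \<open>x^2 = a^n\<close>. The origin
    and \<open>a^n\<close> are the two vertices of column \<open>-1\<close> at level
    \<open>False\<close>, so leaving the strip at either end at that level hits a visited
    vertex.\<close>
  interpret corridor n "if f then int n + 1 else int n - 1" f False "int n - 2"
    using assms by unfold_locales auto
  let ?w = "([] @ [(GenX, b), (GenX, b)]) @ [(GenA, f), (GenA, f)]"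
  have origin: "dic_nf n [] = vtx (- 1) True False" by (simp add: vtx_def)
  have s1: "dic_step n (vtx (- 1) True False) (GenX, b) = vtx (- 1) b True" by simp
  have s2: "dic_step n (vtx (- 1) b True) (GenX, b) = vtx (- 1) False False" by simp
  have s3: "dic_step n (vtx (- 1) False False) (GenA, f) = vtx 0 False False"
    using step_forward[of "- 1"] by simp
  have s4: "dic_step n (vtx 0 False False) (GenA, f) = vtx 1 False False"
    using step_forward[of 0] by simp
  have nf: "dic_nf n ?w = vtx 1 False False"
    unfolding dic_nf_snoc2 origin s1 s2 s3 s4 ..
  have vis: "visited n ?w = {vtx 1 False False, vtx 0 False False, vtx (- 1) False False,
      vtx (- 1) b True, vtx (- 1) True False}"
    unfolding visited_snoc2 dic_nf_snoc2 visited_Nil origin[unfolded dic_nf_Nil] dic_nf_Nil s1 s2 s3 s4 ..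
  have "explored (visited n ?w) 1"
    unfolding explored_def
  proof (intro conjI allI impI)
    fix i :: int assume "even i \<and> 0 \<le> i \<and> i < 1"
    then have "i = 0" by simp
    then show "\<exists>\<rho>. vtx i \<rho> False \<in> visited n ?w \<and> vtx i (\<not> \<rho>) False \<notin> visited n ?w \<and>
        vtx (i + 1) \<rho> False \<in> visited n ?w \<and> (0 < i \<longrightarrow> vtx (i - 1) \<rho> False \<in> visited n ?w)"
      unfolding vis using n by (intro exI[of _ False]) simp
  next
    show "\<exists>l. l \<noteq> (GenA, f) \<and> dic_step n (vtx 0 \<tau> False) l \<in> visited n ?w" for \<tau>
      unfolding vis by (intro exI[of _ "(GenA, \<not> f)"]) (cases \<tau>; simp)
  qed auto
  moreover have "unexplored (visited n ?w) 1"
    unfolding unexplored_def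
  proof (intro conjI allI impI)
    show "vtx i \<tau> False \<notin> visited n ?w" if "1 < i \<and> i \<le> int n - 2" for i \<tau>
      unfolding vis using that by simp
    show "vtx i \<tau> (\<not> False) \<notin> visited n ?w" if "1 < i \<and> i < int n - 2" for i \<tau>
      unfolding vis using that by simp
    have "vtx (int n - 1) \<tau> False = vtx (- 1) (\<not> \<tau>) False" for \<tau>
      using vtx_antipode[of "- 1" \<tau> False] by simp
    then show "\<exists>l. l \<noteq> (GenA, \<not> f) \<and> dic_step n (vtx (int n - 2) \<tau> False) l \<in> visited n ?w" for \<tau>
      unfolding vis by (intro exI[of _ "(GenA, f)"]) (cases \<tau>; simp)
  qed
  ultimately have "fresh ?w 1 False"
    unfolding fresh_def nf using n by (simp add: vis[simplified])
  then have "lost n ?w" by (rule lost_fresh)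
  then show ?thesis by simp
qed

text \<open>A third \<open>x\<close> is answered by completing \<open>x^4 = e\<close>, and a letter
  of \<open>a\<close> by its repetition.\<close>

lemma lost_xx:
  assumes n: "even n" "2 \<le> n"
  shows "lost n [(GenX, b), (GenX, b)]"
proof -
  let ?w = "[] @ [(GenX, b), (GenX, b)]"
  have nf: "dic_nf n ?w = (int n, False)"
    and vis: "visited n ?w = {(0, False), (if b then 0 else int n, True), (int n, False)}"
    unfolding dic_nf_snoc2 visited_snoc2 using n by auto
  have "answered n ?w l" if l: "allowed ?w l" for l
  proof -
    obtain g b' where gb: "l = (g, b')" by force
    show ?thesis
    proof (cases g)
      case GenX
      with l gb have l: "l = (GenX, b)" by (auto simp: allowed_def inv_letter_def)
      show ?thesis unfolding l
      proof (rule answeredI)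
        show "dic_step n (dic_nf n ?w) (GenX, b) \<notin> visited n ?w"
          unfolding nf vis using n by auto
        show "dic_step n (dic_step n (dic_nf n ?w) (GenX, b)) (GenX, b) \<in> visited n ?w \<or>
            lost n (?w @ [(GenX, b), (GenX, b)])"
          unfolding nf vis by auto
      qed (simp add: inv_letter_def)
    next
      case GenA
      have fwd: "(int n + 1) mod (2 * int n) = int n + 1" "(int n - 1) mod (2 * int n) = int n - 1"
        using n by auto
      show ?thesis unfolding gb GenA
      proof (rule answeredI)
        show "dic_step n (dic_nf n ?w) (GenA, b') \<notin> visited n ?w"
          unfolding nf vis using n by (auto simp: fwd)
        show "dic_step n (dic_step n (dic_nf n ?w) (GenA, b')) (GenA, b') \<in> visited n ?w \<or>
            lost n (?w @ [(GenA, b'), (GenA, b')])"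
        proof (cases "n = 2")
          \<comment> \<open>For \<open>n = 2\<close> the strip is too short, but the repeated letter
            already reaches the origin.\<close>
          case True
          then show ?thesis unfolding nf vis by (cases b') auto
        next
          case False
          with n have "4 \<le> n" by presburger
          then show ?thesis using lost_xx_straight[OF n(1)] by simp
        qed
      qed (simp add: inv_letter_def)
    qed
  qed
  then show ?thesis by (simp add: lost_iff_answered[of n "[(GenX, b), (GenX, b)]"])
qed

text \<open>The first letter is repeated; the resulting squares are the starting positions of
  \<open>lost_straight\<close> and \<open>lost_xx\<close>.\<close>

lemma lost_Nil:
  assumes n: "even n" "2 \<le> n"
  shows "lost n []"
proof -
  have "answered n [] l" for l
  proof -
    obtain g b where l: "l = (g, b)" by force
    have "lost n ([] @ [l, l])"
      using lost_xx[OF n, of b] lost_straight[OF n(1), of 2 b] n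
      by (cases g) (auto simp: l numeral_2_eq_2)
    moreover have "dic_step n (dic_nf n []) l \<notin> visited n []"
      using n by (cases g) (auto simp: l zmod_minus1)
    ultimately show ?thesis
      by (intro answeredI[where l' = l]) (auto simp: inv_letter_def l)
  qed
  then show ?thesis by (simp add: lost_iff_answered[of n "[]"])
qed

theorem theorem4p4:
  fixes n :: nat
  assumes "even n" and "n \<ge> 2"
  shows "has_winning_strategy (Dic n) {dic_a n, dic_x n} Player2"
  using assms by (intro has_winning_strategy_if_lost lost_Nil)

end
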